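(* Let $G$ be a graph with $n$ vertices and $m$ edges including $k$ internal edges. Assume $G$ does not contain isolated vertices nor $P_2$ as a component. Let $t'$ be the number of components of $G$ isomorphic to $P_3$. Let $t$ be a non-negative integer. If $G \cup tP_3$ is antimagic, then $$t \leq \min \left\{ (3 + 2\sqrt{2})(m -n)+(1 + \sqrt{2})\left(m +\tfrac{1}{2}\right), \ 2m + 5(k-t') +1 \right\}.$$
   Context: Graphs are finite and simple, not necessarily connected. For a graph $G$ with $m$ edges and a bijection $f: E(G)\to\{1,2,\dots,m\}$, let $\phi_f(v)$ be the sum of $f(e)$ over all edges $e$ incident to the vertex $v$. The bijection $f$ is an antimagic labeling of $G$ if $\phi_f(u)\neq\phi_f(v)$ for all pairs of distinct vertices $u,v$; $G$ is antimagic if it admits an antimagic labeling. $P_j$ denotes the path on $j$ vertices (so $P_2$ is a single edge and $P_3$ has two edges). $G\cup H$ denotes the disjoint union of $G$ and $H$, and $tG$ the disjoint union of $t$ copies of $G$. An edge is internal if both of its ends are non-leaf vertices (vertices of degree different from 1); otherwise it is a pendant edge. *)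

theory Defs
  imports Complex_Main
begin

record 'a ugraph =
  verts :: "'a set"
  edges :: "'a set set"

definition simple_graph :: "'a ugraph \<Rightarrow> bool" where
  "simple_graph G \<longleftrightarrow>
     finite (verts G) \<and> (\<forall>e \<in> edges G. e \<subseteq> verts G \<and> card e = 2)"

definition incident_edges :: "'a ugraph \<Rightarrow> 'a \<Rightarrow> 'a set set" where
  "incident_edges G v = {e \<in> edges G. v \<in> e}"

definition degree :: "'a ugraph \<Rightarrow> 'a \<Rightarrow> nat" where
  "degree G v = card (incident_edges G v)"

definition isolated :: "'a ugraph \<Rightarrow> 'a \<Rightarrow> bool" where
  "isolated G v \<longleftrightarrow> v \<in> verts G \<and> degree G v = 0"

definition leaf :: "'a ugraph \<Rightarrow> 'a \<Rightarrow> bool" where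
  "leaf G v \<longleftrightarrow> v \<in> verts G \<and> degree G v = 1"

definition internal_edges :: "'a ugraph \<Rightarrow> 'a set set" where
  "internal_edges G = {e \<in> edges G. \<forall>v \<in> e. \<not> leaf G v}"

definition vertex_sum :: "'a ugraph \<Rightarrow> ('a set \<Rightarrow> nat) \<Rightarrow> 'a \<Rightarrow> nat" where
  "vertex_sum G f v = (\<Sum>e \<in> incident_edges G v. f e)"

definition antimagic_labeling :: "'a ugraph \<Rightarrow> ('a set \<Rightarrow> nat) \<Rightarrow> bool" where
  "antimagic_labeling G f \<longleftrightarrow>
     bij_betw f (edges G) {1..card (edges G)} \<and>
     (\<forall>u \<in> verts G. \<forall>v \<in> verts G. u \<noteq> v \<longrightarrow> vertex_sum G f u \<noteq> vertex_sum G f v)"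

definition antimagic :: "'a ugraph \<Rightarrow> bool" where
  "antimagic G \<longleftrightarrow> (\<exists>f. antimagic_labeling G f)"

definition isomorphic :: "'a ugraph \<Rightarrow> 'b ugraph \<Rightarrow> bool" where
  "isomorphic G H \<longleftrightarrow>
     (\<exists>h. bij_betw h (verts G) (verts H) \<and>
          (\<forall>u \<in> verts G. \<forall>v \<in> verts G. {u, v} \<in> edges G \<longleftrightarrow> {h u, h v} \<in> edges H))"

definition adjacent :: "'a ugraph \<Rightarrow> 'a \<Rightarrow> 'a \<Rightarrow> bool" where
  "adjacent G u v \<longleftrightarrow> {u, v} \<in> edges G"

definition induced_subgraph :: "'a ugraph \<Rightarrow> 'a set \<Rightarrow> 'a ugraph" where
  "induced_subgraph G W = \<lparr>verts = W, edges = {e \<in> edges G. e \<subseteq> W}\<rparr>"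

definition components :: "'a ugraph \<Rightarrow> 'a ugraph set" where
  "components G = (\<lambda>v. induced_subgraph G {w. (adjacent G)\<^sup>*\<^sup>* v w}) ` verts G"

text \<open>The path on \<open>j\<close> vertices, hence with \<open>j - 1\<close> edges.\<close>

definition path_graph :: "nat \<Rightarrow> nat ugraph" where
  "path_graph j = \<lparr>verts = {..<j}, edges = {{i, Suc i} | i. Suc i < j}\<rparr>"

definition disjoint_union :: "'a ugraph \<Rightarrow> 'b ugraph \<Rightarrow> ('a + 'b) ugraph" where
  "disjoint_union G H =
     \<lparr>verts = verts G <+> verts H,
      edges = (`) Inl ` edges G \<union> (`) Inr ` edges H\<rparr>"

definition copies :: "nat \<Rightarrow> 'a ugraph \<Rightarrow> (nat \<times> 'a) ugraph" where
  "copies t G =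
     \<lparr>verts = {..<t} \<times> verts G,
      edges = {Pair i ` e | i e. i < t \<and> e \<in> edges G}\<rparr>"

end

theory Submission
  imports Defs
begin

text \<open>
  The union \<open>H = G \<union> tP\<^sub>3\<close> has \<open>N = n + 3t\<close> vertices, \<open>M = m + 2t\<close> edges and \<open>k\<close> internal
  edges. Both bounds say that its labels do not add up to enough for the vertex sums to be
  distinct: distinct integers above a given number cannot have a small sum
  (\<open>sum_distinct_above_ge\<close>).

  For the first bound, the \<open>N\<close> vertex sums are distinct and positive, and each label is counted
  at two vertices, so \<open>N (N + 1) / 2 \<le> M (M + 1)\<close> (\<open>card_verts_bound\<close>). Since a copy of \<open>P\<^sub>3\<close> adds
  three vertices but only two edges, the left side grows like \<open>9t\<^sup>2 / 2\<close> and the right side only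
  like \<open>4t\<^sup>2\<close>. Taking square roots and multiplying by \<open>3 + 2\<surd>2 = 1 / (3 - 2\<surd>2)\<close> yields the bound.

  For the second bound, consider the \<open>T = t + t'\<close> centres of the \<open>P\<^sub>3\<close> components of \<open>H\<close>. A centre
  whose sum is at most \<open>M\<close> has the label of some edge as its sum; that edge has no leaf, for the
  sum at a leaf is the label of its only edge. So at most \<open>k\<close> centres have such a sum, by
  injectivity (\<open>card_small_sums_le\<close>). The remaining centres, \<open>S\<close> in number, have distinct sums
  above \<open>M\<close>, yet these are formed from \<open>2S\<close> different labels of size at most \<open>M\<close>; this forces
  \<open>5S \<le> 2M + 1\<close> (\<open>card_large_sums_le\<close>). Hence \<open>5(t + t') \<le> 2(m + 2t) + 5k + 1\<close>, which rearranges
  to the claim. What makes the count work is that the centres have degree two and are pairwise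
  nonadjacent, so that their labels are disjoint pairs (\<open>independent_degree_two_bound\<close>).
\<close>

section \<open>Sums of distinct integers\<close>

lemma sum_distinct_above_ge:
  fixes S :: "nat set"
  assumes "finite S" "\<And>x. x \<in> S \<Longrightarrow> b < x"
  shows "card S * (2 * b + card S + 1) \<le> 2 * \<Sum>S"
  using assms
proof (induction S rule: finite_linorder_max_induct)
  case empty
  then show ?case by simp
next
  case (insert x A)
  have "insert x A \<subseteq> {b<..x}"
    using insert by (auto intro: less_imp_le)
  then have "card (insert x A) \<le> card {b<..x}"
    by (intro card_mono) auto
  moreover have "x \<notin> A" using insert by auto
  ultimately have "b + card A + 1 \<le> x"
    using insert.hyps insert.prems[of x] by simp
  moreover have "card A * (2 * b + card A + 1) \<le> 2 * \<Sum>A"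
    using insert by auto
  ultimately show ?case
    using insert.hyps \<open>x \<notin> A\<close> by (simp add: algebra_simps)
qed

lemma sum_inj_above_ge:
  fixes g :: "'a \<Rightarrow> nat"
  assumes "finite A" "inj_on g A" "\<And>x. x \<in> A \<Longrightarrow> b < g x"
  shows "card A * (2 * b + card A + 1) \<le> 2 * (\<Sum>x\<in>A. g x)"
  using sum_distinct_above_ge[of "g ` A" b] assms by (auto simp: card_image sum.reindex)

section \<open>Counting in a graph with an antimagic labeling\<close>

lemma simple_graph_finite_edges: "simple_graph G \<Longrightarrow> finite (edges G)"
  unfolding simple_graph_def by (rule finite_subset[of _ "Pow (verts G)"]) auto

lemma simple_graph_finite_incident: "simple_graph G \<Longrightarrow> finite (incident_edges G v)"
  by (simp add: incident_edges_def simple_graph_finite_edges)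

lemma handshake:
  assumes "simple_graph G"
  shows "(\<Sum>v\<in>verts G. vertex_sum G f v) = 2 * (\<Sum>e\<in>edges G. f e)"
proof -
  have fin: "finite (verts G)" "finite (edges G)"
    using assms simple_graph_finite_edges by (auto simp: simple_graph_def)
  have "(\<Sum>v\<in>verts G. vertex_sum G f v) = (\<Sum>v\<in>verts G. \<Sum>e | e \<in> edges G \<and> v \<in> e. f e)"
    by (simp add: vertex_sum_def incident_edges_def)
  also have "\<dots> = (\<Sum>e\<in>edges G. \<Sum>v | v \<in> verts G \<and> v \<in> e. f e)"
    by (rule sum.swap_restrict) (use fin in auto)
  also have "\<dots> = (\<Sum>e\<in>edges G. 2 * f e)"
  proof (rule sum.cong[OF refl])
    fix e assume "e \<in> edges G"
    then have "{v. v \<in> verts G \<and> v \<in> e} = e" "card e = 2"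
      using assms by (auto simp: simple_graph_def)
    then show "(\<Sum>v | v \<in> verts G \<and> v \<in> e. f e) = 2 * f e" by simp
  qed
  finally show ?thesis by (simp add: sum_distrib_left)
qed

lemma antimagic_labeling_pos:
  "antimagic_labeling G f \<Longrightarrow> e \<in> edges G \<Longrightarrow> 0 < f e"
  unfolding antimagic_labeling_def bij_betw_def by fastforce

lemma antimagic_labeling_inj_vertex_sum:
  "antimagic_labeling G f \<Longrightarrow> inj_on (vertex_sum G f) (verts G)"
  unfolding antimagic_labeling_def inj_on_def by blast

lemma antimagic_labeling_total:
  assumes "antimagic_labeling G f"
  shows "2 * (\<Sum>e\<in>edges G. f e) = card (edges G) * (card (edges G) + 1)"
proof -
  have "(\<Sum>e\<in>edges G. f e) = (\<Sum>i\<in>{1..card (edges G)}. i)"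
    using assms sum.reindex_bij_betw[of f "edges G" "{1..card (edges G)}" id]
    by (simp add: antimagic_labeling_def)
  then show ?thesis
    using gauss_sum_from_Suc_0[where 'a = nat] by simp
qed

lemma card_verts_bound:
  assumes "simple_graph G" "antimagic G" "\<not> (\<exists>v. isolated G v)"
  shows "card (verts G) * (card (verts G) + 1) \<le> 2 * (card (edges G) * (card (edges G) + 1))"
proof -
  obtain f where f: "antimagic_labeling G f"
    using assms by (auto simp: antimagic_def)
  \<comment> \<open>Without isolated vertices no vertex sum is the empty sum.\<close>
  have "0 < vertex_sum G f v" if "v \<in> verts G" for v
  proof -
    have "incident_edges G v \<noteq> {}"
      using assms(3) that by (auto simp: isolated_def degree_def)
    then obtain e where "e \<in> incident_edges G v" by blast
    then have "f e \<le> vertex_sum G f v" "0 < f e"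
      using assms f antimagic_labeling_pos[of G f e] simple_graph_finite_incident[of G v]
      unfolding vertex_sum_def
      by (auto intro!: member_le_sum simp: incident_edges_def)
    then show ?thesis by simp
  qed
  then have "card (verts G) * (2 * 0 + card (verts G) + 1) \<le> 2 * (\<Sum>v\<in>verts G. vertex_sum G f v)"
    using assms antimagic_labeling_inj_vertex_sum[OF f]
    by (intro sum_inj_above_ge) (auto simp: simple_graph_def)
  then show ?thesis
    using handshake[OF assms(1), of f] antimagic_labeling_total[OF f] by simp
qed

lemma vertex_sum_leaf:
  assumes "leaf G v" "e \<in> edges G" "v \<in> e"
  shows "vertex_sum G f v = f e"
proof -
  obtain a where a: "incident_edges G v = {a}"
    using assms(1) by (auto simp: leaf_def degree_def card_1_singleton_iff)
  have "e \<in> incident_edges G v" using assms by (simp add: incident_edges_def)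
  with a show ?thesis by (simp add: vertex_sum_def)
qed

text \<open>
  A pendant label is already taken as the sum at the leaf, so a small sum at a nonleaf vertex
  must be the label of an internal edge.
\<close>

lemma card_small_sums_le:
  assumes "simple_graph G" "antimagic_labeling G f"
    and "D \<subseteq> verts G" "\<And>v. v \<in> D \<Longrightarrow> degree G v = 2"
    and "\<And>v. v \<in> D \<Longrightarrow> vertex_sum G f v \<le> card (edges G)"
  shows "card D \<le> card (internal_edges G)"
proof -
  have fin: "finite (internal_edges G)"
    using simple_graph_finite_edges[OF assms(1)] by (simp add: internal_edges_def)
  have "vertex_sum G f v \<in> f ` internal_edges G" if v: "v \<in> D" for v
  proof -
    obtain a where "a \<in> incident_edges G v"
      using assms(4)[OF v] by (fastforce simp: degree_def)
    then have "f a \<le> vertex_sum G f v" "0 < f a"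
      using assms antimagic_labeling_pos[of G f a] simple_graph_finite_incident[of G v]
      unfolding vertex_sum_def
      by (auto intro!: member_le_sum simp: incident_edges_def)
    then have "vertex_sum G f v \<in> {1..card (edges G)}"
      using assms(5)[OF v] by simp
    then obtain e where e: "e \<in> edges G" "f e = vertex_sum G f v"
      using assms(2) unfolding antimagic_labeling_def bij_betw_def by (metis imageE)
    have "\<not> leaf G u" if "u \<in> e" for u
    proof
      assume u: "leaf G u"
      then have "vertex_sum G f u = vertex_sum G f v"
        using vertex_sum_leaf[OF u e(1) that] e(2) by simp
      moreover have "u \<noteq> v" using u assms(4)[OF v] by (auto simp: leaf_def)
      ultimately show False
        using u v assms(2,3) by (auto simp: antimagic_labeling_def leaf_def)
    qed
    then have "e \<in> internal_edges G" using e by (simp add: internal_edges_def)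
    then show ?thesis using e by (metis imageI)
  qed
  then have "vertex_sum G f ` D \<subseteq> f ` internal_edges G" by blast
  then have "card (vertex_sum G f ` D) \<le> card (f ` internal_edges G)"
    using fin by (intro card_mono) auto
  also have "\<dots> \<le> card (internal_edges G)" using fin by (rule card_image_le)
  finally show ?thesis
    using inj_on_subset[OF antimagic_labeling_inj_vertex_sum[OF assms(2)] assms(3)]
    by (simp add: card_image)
qed

definition independent_set :: "'a ugraph \<Rightarrow> 'a set \<Rightarrow> bool" where
  "independent_set G C \<longleftrightarrow> C \<subseteq> verts G \<and> (\<forall>u\<in>C. \<forall>v\<in>C. {u, v} \<notin> edges G)"

lemma independent_incident_disjoint:
  assumes "simple_graph G" "independent_set G C" "u \<in> C" "v \<in> C" "u \<noteq> v"
  shows "incident_edges G u \<inter> incident_edges G v = {}"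
proof (rule ccontr)
  assume "\<not> ?thesis"
  then obtain e where e: "e \<in> edges G" "u \<in> e" "v \<in> e"
    by (auto simp: incident_edges_def)
  then have "card e = 2" using assms(1) by (simp add: simple_graph_def)
  then have "e = {u, v}" using e assms(5) by (auto simp: card_2_iff)
  then show False using e assms by (auto simp: independent_set_def)
qed

text \<open>
  The edges at \<open>B\<close> carry \<open>2 * card B\<close> of the labels, and the sum of these is large because the
  sums at \<open>B\<close> are distinct and exceed the number of edges. The other labels are distinct positive
  integers. Together both groups must not exceed the sum of all labels.
\<close>

lemma card_large_sums_le:
  assumes "simple_graph G" "antimagic_labeling G f"
    and "independent_set G B" "\<And>v. v \<in> B \<Longrightarrow> degree G v = 2"
    and "\<And>v. v \<in> B \<Longrightarrow> card (edges G) < vertex_sum G f v"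
  shows "5 * card B \<le> 2 * card (edges G) + 1"
proof -
  define EB where "EB = (\<Union>v\<in>B. incident_edges G v)"
  define M S where "M = card (edges G)" and "S = card B"
  have BV: "B \<subseteq> verts G" using assms by (simp add: independent_set_def)
  have fin: "finite (edges G)" "finite B"
    using assms BV simple_graph_finite_edges finite_subset by (auto simp: simple_graph_def)
  have EB: "EB \<subseteq> edges G" by (auto simp: EB_def incident_edges_def)
  have disj: "\<forall>u\<in>B. \<forall>v\<in>B. u \<noteq> v \<longrightarrow> incident_edges G u \<inter> incident_edges G v = {}"
    using independent_incident_disjoint[OF assms(1,3)] by blast
  have fini: "\<forall>v\<in>B. finite (incident_edges G v)"
    using simple_graph_finite_incident[OF assms(1)] by blast
  have "card EB = (\<Sum>v\<in>B. card (incident_edges G v))"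
    unfolding EB_def using fin fini disj by (intro card_UN_disjoint) auto
  then have cardEB: "card EB = 2 * S"
    using assms(4) by (simp add: degree_def S_def)
  have le: "2 * S \<le> M"
    using card_mono[OF fin(1) EB] cardEB by (simp add: M_def)
  have "S * (2 * M + S + 1) \<le> 2 * (\<Sum>v\<in>B. vertex_sum G f v)"
    unfolding S_def M_def
    using fin assms(5) inj_on_subset[OF antimagic_labeling_inj_vertex_sum[OF assms(2)] BV]
    by (intro sum_inj_above_ge) auto
  also have "(\<Sum>v\<in>B. vertex_sum G f v) = (\<Sum>e\<in>EB. f e)"
    unfolding EB_def vertex_sum_def using fin fini disj
    by (intro sum.UNION_disjoint[symmetric]) auto
  finally have 1: "S * (2 * M + S + 1) \<le> 2 * (\<Sum>e\<in>EB. f e)" .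
  have "card (edges G - EB) = M - 2 * S"
    using card_Diff_subset[of EB "edges G"] EB fin finite_subset cardEB by (auto simp: M_def)
  moreover have "inj_on f (edges G - EB)"
    using assms(2) unfolding antimagic_labeling_def bij_betw_def by (blast intro: inj_on_subset)
  ultimately have 2: "(M - 2 * S) * (M - 2 * S + 1) \<le> 2 * (\<Sum>e\<in>edges G - EB. f e)"
    using sum_inj_above_ge[of "edges G - EB" f 0] fin antimagic_labeling_pos[OF assms(2)] by auto
  have 3: "2 * (\<Sum>e\<in>EB. f e) + 2 * (\<Sum>e\<in>edges G - EB. f e) = M * (M + 1)"
    using sum.subset_diff[OF EB fin(1), of f] antimagic_labeling_total[OF assms(2)]
    by (simp add: M_def)
  obtain p where p: "M = p + 2 * S" using le by (metis le_add_diff_inverse2)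
  have "S * (2 * M + S + 1) + p * (p + 1) \<le> M * (M + 1)"
    using 1 2 3 p by simp
  then have "S * S \<le> S * (2 * p + 1)"
    unfolding p by (simp add: algebra_simps)
  then have "S \<le> 2 * p + 1" by (subst (asm) mult_le_cancel1) auto
  then show ?thesis using p by (simp add: M_def S_def)
qed

lemma independent_degree_two_bound:
  assumes "simple_graph G" "antimagic G"
    and "independent_set G C" "\<And>v. v \<in> C \<Longrightarrow> degree G v = 2"
  shows "5 * card C \<le> 2 * card (edges G) + 5 * card (internal_edges G) + 1"
proof -
  obtain f where f: "antimagic_labeling G f"
    using assms by (auto simp: antimagic_def)
  define D where "D = {v \<in> C. vertex_sum G f v \<le> card (edges G)}"
  define B where "B = {v \<in> C. card (edges G) < vertex_sum G f v}"
  have "finite C"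
    using assms finite_subset by (auto simp: independent_set_def simple_graph_def)
  moreover have "C = D \<union> B" "D \<inter> B = {}" by (auto simp: D_def B_def)
  ultimately have "card C = card D + card B" by (simp add: card_Un_disjoint)
  moreover have "card D \<le> card (internal_edges G)"
    using assms f by (intro card_small_sums_le) (auto simp: D_def independent_set_def)
  moreover have "5 * card B \<le> 2 * card (edges G) + 1"
    using assms f by (intro card_large_sums_le) (auto simp: B_def independent_set_def)
  ultimately show ?thesis by simp
qed

section \<open>Disjoint unions and copies\<close>

lemma simple_graph_edge_nonempty: "simple_graph G \<Longrightarrow> e \<in> edges G \<Longrightarrow> e \<noteq> {}"
  by (auto simp: simple_graph_def)

lemma incident_disjoint_union:
  "incident_edges (disjoint_union G H) (Inl v) = (`) Inl ` incident_edges G v"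
  "incident_edges (disjoint_union G H) (Inr w) = (`) Inr ` incident_edges H w"
  by (auto simp: incident_edges_def disjoint_union_def)

lemma inj_image_on: "inj g \<Longrightarrow> inj_on ((`) g) A"
  by (simp add: inj_on_def inj_image_eq_iff)

lemma degree_disjoint_union:
  "degree (disjoint_union G H) (Inl v) = degree G v"
  "degree (disjoint_union G H) (Inr w) = degree H w"
  by (simp_all add: degree_def incident_disjoint_union card_image inj_image_on)

lemma leaf_disjoint_union:
  "leaf (disjoint_union G H) (Inl v) = leaf G v"
  "leaf (disjoint_union G H) (Inr w) = leaf H w"
  by (auto simp: leaf_def degree_disjoint_union) (auto simp: disjoint_union_def)

lemma simple_graph_disjoint_union:
  "simple_graph G \<Longrightarrow> simple_graph H \<Longrightarrow> simple_graph (disjoint_union G H)"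
  by (fastforce simp: simple_graph_def disjoint_union_def card_image)

lemma card_edges_disjoint_union:
  assumes "simple_graph G" "simple_graph H"
  shows "card (edges (disjoint_union G H)) = card (edges G) + card (edges H)"
proof -
  have "((`) Inl ` edges G) \<inter> ((`) Inr ` edges H) = {}"
    using simple_graph_edge_nonempty[OF assms(1)] by blast
  then show ?thesis
    using simple_graph_finite_edges[OF assms(1)] simple_graph_finite_edges[OF assms(2)]
    by (simp add: disjoint_union_def card_Un_disjoint card_image inj_image_on)
qed

lemma internal_edges_disjoint_union:
  "internal_edges (disjoint_union G H) =
     (`) Inl ` internal_edges G \<union> (`) Inr ` internal_edges H"
  by (auto simp: internal_edges_def leaf_disjoint_union)
     (auto simp: disjoint_union_def leaf_disjoint_union[unfolded disjoint_union_def])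

lemma incident_copies:
  "i < t \<Longrightarrow> incident_edges (copies t G) (i, v) = (`) (Pair i) ` incident_edges G v"
  by (auto simp: incident_edges_def copies_def)

lemma degree_copies: "i < t \<Longrightarrow> degree (copies t G) (i, v) = degree G v"
  by (simp add: degree_def incident_copies card_image inj_image_on inj_def)

lemma leaf_copies: "i < t \<Longrightarrow> leaf (copies t G) (i, v) = leaf G v"
  by (simp add: leaf_def degree_copies) (simp add: copies_def)

lemma edges_copies:
  "edges (copies t G) = (\<lambda>(i, e). Pair i ` e) ` ({..<t} \<times> edges G)"
  by (auto simp: copies_def)

lemma simple_graph_copies:
  assumes "simple_graph G"
  shows "simple_graph (copies t G)"
proof -
  have "card (Pair i ` e) = card e" for i :: nat and e :: "'a set"
    by (simp add: card_image inj_on_def)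
  then show ?thesis
    using assms by (fastforce simp: simple_graph_def copies_def)
qed

lemma card_edges_copies:
  assumes "simple_graph G"
  shows "card (edges (copies t G)) = t * card (edges G)"
proof -
  have "inj_on (\<lambda>(i, e). Pair i ` e) ({..<t} \<times> edges G)"
  proof (rule inj_onI, clarify)
    fix i j :: nat and d e
    assume "d \<in> edges G" and eq: "Pair i ` d = Pair j ` e"
    then obtain x where "x \<in> d" using simple_graph_edge_nonempty[OF assms] by blast
    then have "(i, x) \<in> Pair j ` e" using eq by blast
    then have "i = j" by blast
    with eq show "i = j \<and> d = e" by (simp add: inj_image_eq_iff inj_def)
  qed
  then show ?thesis by (simp add: edges_copies card_image card_cartesian_product)
qed

lemma internal_edges_copies_empty:
  assumes "internal_edges G = {}"
  shows "internal_edges (copies t G) = {}"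
proof -
  have False if "e \<in> internal_edges (copies t G)" for e
  proof -
    have "e \<in> edges (copies t G)" using that by (simp add: internal_edges_def)
    then obtain i d where d: "i < t" "d \<in> edges G" "e = Pair i ` d"
      by (auto simp: copies_def)
    then obtain v where "v \<in> d" "leaf G v"
      using assms by (auto simp: internal_edges_def)
    then show False using that d by (auto simp: internal_edges_def leaf_copies)
  qed
  then show ?thesis by blast
qed

section \<open>Paths on three vertices\<close>

lemma edges_path_3: "edges (path_graph 3) = {{0, 1}, {1, 2}}"
proof -
  have "{{i, Suc i} | i. Suc i < 3} = {{0, 1}, {1, 2 :: nat}}"
    by (auto simp: less_Suc_eq numeral_3_eq_3 numeral_2_eq_2)
  then show ?thesis by (simp add: path_graph_def)
qed

lemma verts_path_3: "verts (path_graph 3) = {0, 1, 2}"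
  by (auto simp: path_graph_def)

lemma card_edges_path_3: "card (edges (path_graph 3)) = 2"
  by (simp add: edges_path_3 doubleton_eq_iff)

lemma simple_graph_path_3: "simple_graph (path_graph 3)"
  by (simp add: simple_graph_def edges_path_3 verts_path_3)

lemma incident_path_3:
  "incident_edges (path_graph 3) 0 = {{0, 1}}"
  "incident_edges (path_graph 3) 1 = {{0, 1}, {1, 2}}"
  "incident_edges (path_graph 3) 2 = {{1, 2}}"
  by (auto simp: incident_edges_def edges_path_3)

lemma degree_path_3:
  "degree (path_graph 3) 0 = 1" "degree (path_graph 3) 1 = 2" "degree (path_graph 3) 2 = 1"
  unfolding degree_def incident_path_3 by (simp_all add: doubleton_eq_iff)

lemma internal_edges_path_3: "internal_edges (path_graph 3) = {}"
proof -
  have "leaf (path_graph 3) 0" "leaf (path_graph 3) 2"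
    by (simp_all add: leaf_def degree_path_3 verts_path_3)
  then show ?thesis by (auto simp: internal_edges_def edges_path_3)
qed

lemma reachable_sym: "(adjacent G)\<^sup>*\<^sup>* u v \<Longrightarrow> (adjacent G)\<^sup>*\<^sup>* v u"
  by (rule sympD[OF symp_rtranclp]) (auto simp: symp_def adjacent_def insert_commute)

lemma component_eq_induced:
  assumes "D \<in> components G" "c \<in> verts D"
  shows "D = induced_subgraph G {w. (adjacent G)\<^sup>*\<^sup>* c w}"
proof -
  obtain v where D: "D = induced_subgraph G {w. (adjacent G)\<^sup>*\<^sup>* v w}"
    using assms by (auto simp: components_def)
  then have "(adjacent G)\<^sup>*\<^sup>* v c" using assms by (simp add: induced_subgraph_def)
  then have "{w. (adjacent G)\<^sup>*\<^sup>* v w} = {w. (adjacent G)\<^sup>*\<^sup>* c w}"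
    by (auto intro: rtranclp_trans reachable_sym)
  with D show ?thesis by simp
qed

lemma component_verts_subset:
  assumes "simple_graph G" "D \<in> components G"
  shows "verts D \<subseteq> verts G"
proof -
  obtain v where v: "v \<in> verts G" and D: "D = induced_subgraph G {w. (adjacent G)\<^sup>*\<^sup>* v w}"
    using assms by (auto simp: components_def)
  have "w \<in> verts G" if "(adjacent G)\<^sup>*\<^sup>* v w" for w
    using that
  proof cases
    case rtrancl_refl
    then show ?thesis using v by simp
  next
    case (rtrancl_into_rtrancl u)
    then have "{u, w} \<in> edges G" by (simp add: adjacent_def)
    then show ?thesis using assms(1) by (auto simp: simple_graph_def)
  qed
  then show ?thesis by (auto simp: D induced_subgraph_def)
qed

text \<open>
  The centre has the same degree in \<open>G\<close> as in its component, since a component contains all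
  neighbours of each of its vertices.
\<close>

lemma path_3_component_centre:
  fixes G D :: "'a ugraph"
  assumes "simple_graph G" "D \<in> components G" "isomorphic D (path_graph 3)"
  shows "\<exists>c\<in>verts D. degree G c = 2"
proof -
  have "\<exists>h :: 'a \<Rightarrow> nat. bij_betw h (verts D) {0, 1, 2} \<and>
      (\<forall>u\<in>verts D. \<forall>v\<in>verts D. {u, v} \<in> edges D \<longleftrightarrow> {h u, h v} \<in> {{0, 1}, {1, 2}})"
    using assms(3) unfolding isomorphic_def edges_path_3 verts_path_3 .
  then obtain h :: "'a \<Rightarrow> nat" where h: "bij_betw h (verts D) {0, 1, 2}"
    and edge: "\<forall>u\<in>verts D. \<forall>v\<in>verts D. {u, v} \<in> edges D \<longleftrightarrow> {h u, h v} \<in> {{0, 1}, {1, 2}}"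
    by (elim exE conjE)
  have "0 \<in> h ` verts D" "1 \<in> h ` verts D" "2 \<in> h ` verts D"
    using h by (simp_all add: bij_betw_def)
  then obtain a c b where abc: "a \<in> verts D" "b \<in> verts D" "c \<in> verts D"
    "h a = 0" "h c = 1" "h b = 2" by (metis imageE)
  have cD: "D = induced_subgraph G {w. (adjacent G)\<^sup>*\<^sup>* c w}"
    using component_eq_induced[OF assms(2) abc(3)] .
  have edges_D: "edges D \<subseteq> edges G"
    by (subst cD) (auto simp: induced_subgraph_def)
  have "{c, a} \<in> edges D" "{c, b} \<in> edges D"
    using edge[rule_format, OF abc(3,1)] edge[rule_format, OF abc(3,2)] abc(4-6) by (simp_all add: insert_commute)
  then have "{{c, a}, {c, b}} \<subseteq> incident_edges G c"
    using edges_D by (auto simp: incident_edges_def)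
  moreover have "incident_edges G c \<subseteq> {{c, a}, {c, b}}"
  proof
    fix e assume e: "e \<in> incident_edges G c"
    then have "card e = 2" "c \<in> e" using assms(1)
      by (auto simp: incident_edges_def simple_graph_def)
    then obtain w where w: "e = {c, w}" by (auto simp: card_2_iff)
    have "adjacent G c w" using e w by (simp add: incident_edges_def adjacent_def)
    then have wD: "w \<in> verts D" and "{c, w} \<in> edges D"
      using e w by (subst cD, simp add: induced_subgraph_def incident_edges_def r_into_rtranclp)+
    then have "h w = 0 \<or> h w = 2"
      using edge[rule_format, OF abc(3) wD] abc by (auto simp: doubleton_eq_iff)
    then have "w = a \<or> w = b"
      using h wD abc by (auto simp: bij_betw_def inj_on_def)
    then show "e \<in> {{c, a}, {c, b}}" using w by auto
  qed
  moreover have "a \<noteq> b" using abc by auto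
  ultimately have "incident_edges G c = {{c, a}, {c, b}}" "{c, a} \<noteq> {c, b}"
    by (blast, metis doubleton_eq_iff)
  then have "degree G c = 2" by (simp add: degree_def)
  then show ?thesis using abc by blast
qed

lemma path_3_centres:
  assumes "simple_graph G"
  obtains C where "independent_set G C" "\<And>v. v \<in> C \<Longrightarrow> degree G v = 2"
    "card C = card {D \<in> components G. isomorphic D (path_graph 3)}"
proof -
  define P where "P = {D \<in> components G. isomorphic D (path_graph 3)}"
  obtain c where c: "\<And>D. D \<in> P \<Longrightarrow> c D \<in> verts D" "\<And>D. D \<in> P \<Longrightarrow> degree G (c D) = 2"
    using path_3_component_centre[OF assms] unfolding P_def by (metis (mono_tags) mem_Collect_eq)
  have comp: "D = induced_subgraph G {w. (adjacent G)\<^sup>*\<^sup>* (c D) w}" if "D \<in> P" for D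
    by (rule component_eq_induced) (use that c in \<open>simp_all add: P_def\<close>)
  have "inj_on c P" by (rule inj_onI) (metis comp)
  moreover have "{c D, c D'} \<notin> edges G" if "D \<in> P" "D' \<in> P" for D D'
  proof
    assume e: "{c D, c D'} \<in> edges G"
    then have "(adjacent G)\<^sup>*\<^sup>* (c D) (c D')" by (simp add: adjacent_def r_into_rtranclp)
    then have "c D' \<in> verts D"
      by (subst comp[OF that(1)]) (simp add: induced_subgraph_def)
    then have "D = D'"
      using component_eq_induced[of D G "c D'"] comp[OF that(2)] that by (simp add: P_def)
    \<comment> \<open>An edge has two ends, so there is no loop at the centre.\<close>
    then show False using e assms by (auto simp: simple_graph_def)
  qed
  moreover have "c ` P \<subseteq> verts G"
    using c component_verts_subset[OF assms] by (fastforce simp: P_def)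
  ultimately have "independent_set G (c ` P)" "card (c ` P) = card P"
    by (auto simp: independent_set_def card_image)
  moreover have "degree G v = 2" if "v \<in> c ` P" for v using c(2) that by blast
  ultimately show ?thesis using that unfolding P_def by blast
qed

section \<open>Adding paths on three vertices\<close>

context
  fixes G :: "'a ugraph" and t :: nat
  assumes G: "simple_graph G"
begin

abbreviation (input) "G_paths \<equiv> disjoint_union G (copies t (path_graph 3))"

lemma simple_graph_G_paths: "simple_graph G_paths"
  by (intro simple_graph_disjoint_union simple_graph_copies simple_graph_path_3 G)

lemma card_verts_G_paths: "card (verts G_paths) = card (verts G) + 3 * t"
  using G
  by (simp add: disjoint_union_def copies_def card_Plus card_cartesian_product
      verts_path_3 simple_graph_def)

lemma card_edges_G_paths: "card (edges G_paths) = card (edges G) + 2 * t"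
  by (simp add: card_edges_disjoint_union card_edges_copies simple_graph_copies
      simple_graph_path_3 card_edges_path_3 G)

lemma card_internal_edges_G_paths: "card (internal_edges G_paths) = card (internal_edges G)"
  by (simp add: internal_edges_disjoint_union internal_edges_copies_empty internal_edges_path_3
      card_image inj_image_on)

lemma no_isolated_G_paths:
  assumes "\<not> (\<exists>v. isolated G v)"
  shows "\<not> (\<exists>v. isolated G_paths v)"
proof -
  have False if v: "isolated G_paths v" for v
  proof (cases v)
    case (Inl u)
    then show False using v assms
      by (auto simp: isolated_def degree_disjoint_union) (auto simp: disjoint_union_def)
  next
    case (Inr w)
    obtain i x where w: "w = (i, x)" by (cases w)
    have "i < t" "x \<in> {0, 1, 2}"
      using v Inr w
      by (auto simp: isolated_def disjoint_union_def copies_def verts_path_3)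
    then show False
      using v Inr w degree_path_3
      by (auto simp: isolated_def degree_disjoint_union degree_copies)
  qed
  then show ?thesis by blast
qed

lemma path_3_centres_G_paths:
  obtains C where "independent_set G_paths C" "\<And>v. v \<in> C \<Longrightarrow> degree G_paths v = 2"
    "card C = card {D \<in> components G. isomorphic D (path_graph 3)} + t"
proof -
  obtain C where C: "independent_set G C" "\<And>v. v \<in> C \<Longrightarrow> degree G v = 2"
    "card C = card {D \<in> components G. isomorphic D (path_graph 3)}"
    using path_3_centres[OF G] by blast
  define C' where "C' = C <+> ({..<t} \<times> {1 :: nat})"
  have "finite C" using C(1) G finite_subset by (auto simp: independent_set_def simple_graph_def)
  then have "card C' = card C + t"
    by (simp add: C'_def card_Plus card_cartesian_product)
  moreover have "independent_set G_paths C'"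
  proof -
    have "C' \<subseteq> verts G_paths"
      using C(1) by (auto simp: C'_def independent_set_def disjoint_union_def copies_def verts_path_3)
    moreover have "{u, v} \<notin> edges G_paths" if "u \<in> C'" "v \<in> C'" for u v
    proof
      assume "{u, v} \<in> edges G_paths"
      then consider e where "e \<in> edges G" "{u, v} = Inl ` e"
        | e where "e \<in> edges (copies t (path_graph 3))" "{u, v} = Inr ` e"
        by (auto simp: disjoint_union_def)
      then show False
      proof cases
        case 1
        then obtain x y where xy: "u = Inl x" "v = Inl y" by blast
        then have "(Inl ` e :: ('a + nat \<times> nat) set) = Inl ` {x, y}"
          using 1(2) by (simp only: image_insert image_empty)
        then have "e = {x, y}" by (simp only: inj_image_eq_iff[OF inj_Inl])
        then show False using 1 xy that C(1) by (auto simp: C'_def independent_set_def)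
      next
        case 2
        \<comment> \<open>Every edge of \<open>P\<^sub>3\<close> has an end other than the middle vertex.\<close>
        then have "\<exists>p\<in>e. snd p \<noteq> 1"
          by (fastforce simp: edges_copies edges_path_3)
        then obtain p where "Inr p \<in> {u, v}" "snd p \<noteq> 1" using 2 by blast
        then show False using that by (auto simp: C'_def)
      qed
    qed
    ultimately show ?thesis by (simp add: independent_set_def)
  qed
  moreover have "degree G_paths v = 2" if "v \<in> C'" for v
    using that C(2) degree_path_3
    by (auto simp: C'_def degree_disjoint_union degree_copies)
  ultimately show ?thesis using C(3) that by metis
qed

end

section \<open>The two bounds on the number of paths\<close>

text \<open>
  By completing the square, the hypothesis implies
  \<open>(n + 3t + 1/2)\<^sup>2 \<le> 2 (m + 2t + 1/2)\<^sup>2\<close>; after taking roots it is linear in \<open>t\<close>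
  with coefficient \<open>3 - 2\<surd>2 > 0\<close>.
\<close>

lemma quadratic_count_bound:
  fixes n m t :: real
  assumes nonneg: "0 \<le> m" "0 \<le> t"
    and le: "(n + 3 * t) * (n + 3 * t + 1) \<le> 2 * ((m + 2 * t) * (m + 2 * t + 1))"
  shows "t \<le> (3 + 2 * sqrt 2) * (m - n) + (1 + sqrt 2) * (m + 1 / 2)"
proof -
  have "(n + 3 * t + 1 / 2)\<^sup>2 \<le> 2 * (m + 2 * t + 1 / 2)\<^sup>2"
    using le by (simp add: power2_eq_square algebra_simps)
  also have "\<dots> = (sqrt 2 * (m + 2 * t + 1 / 2))\<^sup>2"
    by (simp add: power_mult_distrib)
  finally have "n + 3 * t + 1 / 2 \<le> sqrt 2 * (m + 2 * t + 1 / 2)"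
    by (rule power2_le_imp_le) (use nonneg in simp)
  then have "(3 + 2 * sqrt 2) * (n + 3 * t + 1 / 2)
      \<le> (3 + 2 * sqrt 2) * (sqrt 2 * (m + 2 * t + 1 / 2))"
    by (intro mult_left_mono) auto
  moreover have "sqrt 2 * (sqrt 2 * x) = 2 * x" for x :: real
    by (simp add: mult.assoc[symmetric])
  ultimately show ?thesis by (simp add: algebra_simps)
qed

theorem theorem1:
  fixes G :: "'a ugraph" and n m k t' t :: nat
  assumes "simple_graph G"
    and "n = card (verts G)"
    and "m = card (edges G)"
    and "k = card (internal_edges G)"
    and "\<not> (\<exists>v. isolated G v)"
    and "\<not> (\<exists>C \<in> components G. isomorphic C (path_graph 2))"
    and "t' = card {C \<in> components G. isomorphic C (path_graph 3)}"
    and "antimagic (disjoint_union G (copies t (path_graph 3)))"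
  shows "real t \<le> min
    ((3 + 2 * sqrt 2) * (real m - real n) + (1 + sqrt 2) * (real m + 1 / 2))
    (2 * real m + 5 * (real k - real t') + 1)"
proof -
  let ?H = "disjoint_union G (copies t (path_graph 3))"
  have H: "simple_graph ?H" by (rule simple_graph_G_paths[OF assms(1)])
  have "(n + 3 * t) * (n + 3 * t + 1) \<le> 2 * ((m + 2 * t) * (m + 2 * t + 1))"
    using card_verts_bound[OF H assms(8) no_isolated_G_paths[OF assms(1,5)]]
    by (simp only: card_verts_G_paths[OF assms(1)] card_edges_G_paths[OF assms(1)] assms(2,3))
  then have "real ((n + 3 * t) * (n + 3 * t + 1)) \<le> real (2 * ((m + 2 * t) * (m + 2 * t + 1)))"
    by (simp only: of_nat_le_iff)
  then have "(real n + 3 * real t) * (real n + 3 * real t + 1)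
      \<le> 2 * ((real m + 2 * real t) * (real m + 2 * real t + 1))"
    by (simp only: of_nat_mult of_nat_add of_nat_1 of_nat_numeral)
  then have first: "real t \<le> (3 + 2 * sqrt 2) * (real m - real n) + (1 + sqrt 2) * (real m + 1 / 2)"
    by (intro quadratic_count_bound) simp_all
  obtain C where "independent_set ?H C" "\<And>v. v \<in> C \<Longrightarrow> degree ?H v = 2" "card C = t' + t"
    using path_3_centres_G_paths[OF assms(1), of t] assms(7) by metis
  then have "5 * (t' + t) \<le> 2 * (m + 2 * t) + 5 * k + 1"
    using independent_degree_two_bound[OF H assms(8)] assms(1,3,4)
    by (metis card_edges_G_paths card_internal_edges_G_paths)
  then have "real t \<le> 2 * real m + 5 * (real k - real t') + 1" by simp
  with first show ?thesis by simp
qed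

end
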